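(* Every non-$\sigma$-compact, regionally elliptic locally compact group is 1-ended.
   Context: Locally compact groups are Hausdorff. A locally compact group is regionally elliptic (or locally elliptic) if each compact subset is contained in some compact open subgroup. For a locally compact group $G$, a subset $X\subset G$ is topologically left-commensurated if $KX\smallsetminus X$ has compact closure for every compact subset $K\subset G$. These subsets form a Boolean subalgebra $\mathcal{P}_{(G)}(G)$ of the power set of $G$, containing the ideal of subsets with compact closure; $\mathcal{P}^\star_G(G)$ denotes the quotient of $\mathcal{P}_{(G)}(G)$ by this ideal. The space of ends of $G$ is the Stone dual of $\mathcal{P}^\star_G(G)$. $G$ is 1-ended if its space of ends is a single point, i.e. $\mathcal{P}^\star_G(G)$ is reduced to $\mathbf{Z}/2\mathbf{Z}=\{0,1\}$ with $0\neq 1$. *)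

theory Defs
  imports "HOL-Analysis.Analysis" "HOL-Algebra.QuotRing" "HOL-Number_Theory.Residues"
begin

section \<open>Locally compact groups\<close>

locale locally_compact_group = group G
  for G :: "('a, 'b) monoid_scheme" (structure) and T :: "'a topology" +
  assumes topspace_eq_carrier: "topspace T = carrier G"
    and continuous_mult: "continuous_map (prod_topology T T) T (\<lambda>(x, y). x \<otimes> y)"
    and continuous_inv: "continuous_map T T (\<lambda>x. inv x)"
    and Hausdorff: "Hausdorff_space T"
    and locally_compact: "locally_compact_space T"

definition sigma_compact_space :: "'a topology \<Rightarrow> bool" where
  "sigma_compact_space T \<longleftrightarrow>
    (\<exists>\<K>. countable \<K> \<and> (\<forall>K\<in>\<K>. compactin T K) \<and> \<Union>\<K> = topspace T)"

definition regionally_elliptic :: "('a, 'b) monoid_scheme \<Rightarrow> 'a topology \<Rightarrow> bool" where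
  "regionally_elliptic G T \<longleftrightarrow>
    (\<forall>K. compactin T K \<longrightarrow> (\<exists>H. subgroup H G \<and> openin T H \<and> compactin T H \<and> K \<subseteq> H))"


section \<open>The Boolean algebra of commensurated subsets\<close>

definition has_compact_closure :: "'a topology \<Rightarrow> 'a set \<Rightarrow> bool" where
  "has_compact_closure T X \<longleftrightarrow> compactin T (T closure_of X)"

definition left_commensurated ::
    "('a, 'b) monoid_scheme \<Rightarrow> 'a topology \<Rightarrow> 'a set \<Rightarrow> bool" where
  "left_commensurated G T X \<longleftrightarrow>
    X \<subseteq> carrier G \<and> (\<forall>K. compactin T K \<longrightarrow> has_compact_closure T ((K <#>\<^bsub>G\<^esub> X) - X))"

text \<open>
  Boolean algebras are treated as commutative rings of idempotents: the product is the meet and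
  the sum is the symmetric difference. This makes the quotient by an ideal
  available as \<^const>\<open>FactRing\<close>.
\<close>

definition commensurated_algebra ::
    "('a, 'b) monoid_scheme \<Rightarrow> 'a topology \<Rightarrow> 'a set ring" where
  "commensurated_algebra G T =
    \<lparr>carrier = {X. left_commensurated G T X},
     mult = (\<inter>),
     one = carrier G,
     zero = {},
     add = (\<lambda>X Y. sym_diff X Y)\<rparr>"

definition compact_closure_ideal :: "('a, 'b) monoid_scheme \<Rightarrow> 'a topology \<Rightarrow> 'a set set" where
  "compact_closure_ideal G T = {X. X \<subseteq> carrier G \<and> has_compact_closure T X}"

definition ends_algebra ::
    "('a, 'b) monoid_scheme \<Rightarrow> 'a topology \<Rightarrow> 'a set set ring" where
  "ends_algebra G T = commensurated_algebra G T Quot compact_closure_ideal G T"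


section \<open>The space of ends\<close>

text \<open>
  The Stone dual of a Boolean algebra \<open>A\<close> is the set of unital homomorphisms from \<open>A\<close> to
  \<open>\<int>/2\<int>\<close> with the topology of pointwise convergence. The points of a product topology are
  functions that are \<^const>\<open>undefined\<close> off the index set, here \<open>carrier A\<close>, so every
  homomorphism is represented exactly once.
\<close>

definition stone_dual :: "('c, 'd) ring_scheme \<Rightarrow> ('c \<Rightarrow> int) topology" where
  "stone_dual A =
    subtopology
      (product_topology (\<lambda>_. discrete_topology (carrier (residue_ring 2))) (carrier A))
      (ring_hom A (residue_ring 2))"

definition space_of_ends ::
    "('a, 'b) monoid_scheme \<Rightarrow> 'a topology \<Rightarrow> ('a set set \<Rightarrow> int) topology" where
  "space_of_ends G T = stone_dual (ends_algebra G T)"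

definition one_ended :: "('a, 'b) monoid_scheme \<Rightarrow> 'a topology \<Rightarrow> bool" where
  "one_ended G T \<longleftrightarrow> (\<exists>\<omega>. topspace (space_of_ends G T) = {\<omega>})"

end

theory Submission
  imports Defs
begin

text \<open>
  Let \<open>X\<close> be a commensurated subset of \<open>G\<close> and suppose that neither \<open>X\<close> nor its complement has
  compact closure. An increasing sequence of compact open subgroups \<open>H n\<close> can be chosen so that
  each one absorbs the error \<open>(H n <#> X) - X\<close> of its predecessor and contains new points both of
  \<open>X\<close> and of its complement. The union \<open>M\<close> of the sequence is an open subgroup that meets \<open>X\<close> and
  its complement in sets without compact closure, and \<open>X - M\<close> is invariant under left
  multiplication by \<open>M\<close>. As \<open>M\<close> is \<open>\<sigma>\<close>-compact, it is not all of \<open>G\<close>, so there is a compact open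
  subgroup \<open>B\<close> that is not contained in \<open>M\<close>; the set \<open>X\<close> is \<open>B\<close>-invariant outside of some compact
  open subgroup \<open>B'\<close>.

  The contradiction comes from edge connectivity in finite graphs. For large \<open>n\<close> put
  \<open>L = \<langle>H n, B\<rangle>\<close> and \<open>A = L \<inter> M\<close>, so that \<open>A\<close> and \<open>B\<close> have finite index in \<open>L\<close>, a
  subgroup of a compact group. Consider the hypergraph whose vertices are the cosets \<open>A #> z\<close> and whose
  hyperedges are the cosets \<open>B #> z\<close>, incidence being nonempty intersection. It is connected
  and \<open>L\<close> acts transitively on its incident pairs. For such a hypergraph, every cut is crossed by at
  least as many hyperedges as pass through one vertex (lemma \<open>card_split_cosets_ge\<close>; Mader's
  theorem on vertex-transitive graphs is the model). The cut is \<open>X \<inter> L - A\<close>: apart from the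
  boundedly many hyperedges inside \<open>B'\<close>, a hyperedge crosses it only if it passes through the
  vertex \<open>A\<close> and lies in \<open>X\<close>. But the number of hyperedges through \<open>A\<close> that avoid \<open>X\<close> grows
  without bound with \<open>n\<close>, so there are too few crossing hyperedges
  (lemma \<open>commensurated_has_compact_closure_or_complement\<close>).

  Thus the algebra of ends has exactly the elements 0 and 1, which differ because \<open>G\<close> is not compact,
  and such an algebra has a unique unital homomorphism to \<open>\<int>/2\<int>\<close>
  (lemma \<open>one_ended_if_commensurated_trivial\<close>).
\<close>

section \<open>Edge connectivity of coset hypergraphs\<close>

text \<open>
  The hyperedges that cross the cut \<open>Y\<close>.
\<close>
definition split_cosets :: "('a, 'b) monoid_scheme \<Rightarrow> 'a set \<Rightarrow> 'a set \<Rightarrow> 'a set set" where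
  "split_cosets G B Y = {C \<in> rcosets\<^bsub>G\<^esub> B. C \<inter> Y \<noteq> {} \<and> \<not> C \<subseteq> Y}"

text \<open>
  Invariance under \<open>A\<close> makes \<open>Y\<close> a union of cosets of \<open>A\<close>, that is, a set of vertices.
\<close>
definition invariant_cut :: "('a, 'b) monoid_scheme \<Rightarrow> 'a set \<Rightarrow> 'a set \<Rightarrow> bool" where
  "invariant_cut G A Y \<longleftrightarrow>
    Y \<subseteq> carrier G \<and> Y \<noteq> {} \<and> Y \<noteq> carrier G \<and> (\<forall>a\<in>A. \<forall>y\<in>Y. a \<otimes>\<^bsub>G\<^esub> y \<in> Y)"

context group
begin

text \<open>
  Every coset that is counted on the left is counted at least as often on the right: a coset split
  by \<open>Y \<inter> Z\<close> or by \<open>Y \<union> Z\<close> is split by one of \<open>Y\<close> and \<open>Z\<close>, and a coset split by both meets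
  \<open>Y \<inter> Z\<close> and leaves \<open>Y \<union> Z\<close>, so that it is split by both \<open>Y\<close> and \<open>Z\<close>.
\<close>
lemma card_split_cosets_submodular:
  assumes "finite (rcosets B)"
  shows "card (split_cosets G B (Y \<inter> Z)) + card (split_cosets G B (Y \<union> Z))
    \<le> card (split_cosets G B Y) + card (split_cosets G B Z)"
proof -
  have fin: "finite (split_cosets G B W)" for W
    using assms unfolding split_cosets_def by simp
  have "card (split_cosets G B (Y \<inter> Z)) + card (split_cosets G B (Y \<union> Z))
      = card (split_cosets G B (Y \<inter> Z) \<union> split_cosets G B (Y \<union> Z))
        + card (split_cosets G B (Y \<inter> Z) \<inter> split_cosets G B (Y \<union> Z))"
    by (rule card_Un_Int) (auto simp: fin)
  also have "\<dots> \<le> card (split_cosets G B Y \<union> split_cosets G B Z)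
      + card (split_cosets G B Y \<inter> split_cosets G B Z)"
  proof (intro add_mono card_mono)
    show "split_cosets G B (Y \<inter> Z) \<union> split_cosets G B (Y \<union> Z)
        \<subseteq> split_cosets G B Y \<union> split_cosets G B Z"
      unfolding split_cosets_def by blast
    show "split_cosets G B (Y \<inter> Z) \<inter> split_cosets G B (Y \<union> Z)
        \<subseteq> split_cosets G B Y \<inter> split_cosets G B Z"
      unfolding split_cosets_def by blast
  qed (auto simp: fin)
  also have "\<dots> = card (split_cosets G B Y) + card (split_cosets G B Z)"
    by (rule card_Un_Int[symmetric]) (auto simp: fin)
  finally show ?thesis .
qed

lemma mem_r_coset_iff:
  assumes "Y \<subseteq> carrier G" "g \<in> carrier G" "z \<in> carrier G"
  shows "z \<in> Y #> g \<longleftrightarrow> z \<otimes> inv g \<in> Y"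
proof
  assume "z \<in> Y #> g"
  then obtain y where y: "y \<in> Y" "z = y \<otimes> g" by (auto simp: r_coset_def)
  have "z \<otimes> inv g = y"
    using assms y by (metis inv_solve_right subsetD)
  with y show "z \<otimes> inv g \<in> Y" by simp
next
  assume "z \<otimes> inv g \<in> Y"
  moreover have "z = (z \<otimes> inv g) \<otimes> g" using assms by (simp add: m_assoc)
  ultimately show "z \<in> Y #> g" unfolding r_coset_def by blast
qed

text \<open>
  Right translation by \<open>g\<close> permutes the cosets of \<open>B\<close>. Only an inequality is recorded, because the
  translates are always compared with minimal cuts.
\<close>
lemma card_split_cosets_translate_le:
  assumes fin: "finite (rcosets B)" and B: "B \<subseteq> carrier G" and Y: "Y \<subseteq> carrier G"
    and g: "g \<in> carrier G"
  shows "card (split_cosets G B (Y #> g)) \<le> card (split_cosets G B Y)"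
proof -
  have "split_cosets G B (Y #> g) \<subseteq> (\<lambda>C. C #> g) ` split_cosets G B Y"
  proof
    fix C assume C: "C \<in> split_cosets G B (Y #> g)"
    then obtain c where c: "c \<in> carrier G" "C = B #> c"
      unfolding split_cosets_def RCOSETS_def by blast
    let ?C = "B #> (c \<otimes> inv g)"
    have CC: "?C #> g = C"
      using c g B by (simp add: coset_mult_assoc m_assoc)
    have sub: "?C \<subseteq> carrier G"
      using B c g by (simp add: r_coset_subset_G)
    have "?C \<in> rcosets B" using B c g by (auto simp: rcosetsI)
    moreover have "?C \<inter> Y \<noteq> {}"
    proof -
      obtain z where z: "z \<in> ?C #> g" "z \<in> Y #> g"
        using C CC unfolding split_cosets_def by blast
      have "z \<in> carrier G" using z(2) Y g by (auto simp: r_coset_def)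
      with z show ?thesis using mem_r_coset_iff sub Y g by blast
    qed
    moreover have "\<not> ?C \<subseteq> Y"
    proof
      assume "?C \<subseteq> Y"
      then have "?C #> g \<subseteq> Y #> g" by (auto simp: r_coset_def)
      then show False using C CC unfolding split_cosets_def by blast
    qed
    ultimately show "C \<in> (\<lambda>C. C #> g) ` split_cosets G B Y"
      using CC unfolding split_cosets_def by blast
  qed
  moreover have "finite (split_cosets G B Y)"
    using fin unfolding split_cosets_def by simp
  ultimately show ?thesis by (meson card_image_le card_mono finite_imageI le_trans)
qed

lemma split_cosets_complement:
  assumes "B \<subseteq> carrier G"
  shows "split_cosets G B (carrier G - Y) = split_cosets G B Y"
proof -
  have "C \<subseteq> carrier G" if "C \<in> rcosets B" for C
    using that assms by (auto simp: RCOSETS_def r_coset_def)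
  then show ?thesis unfolding split_cosets_def by blast
qed

lemma invariant_cut_complement:
  assumes "subgroup A G" "invariant_cut G A Y"
  shows "invariant_cut G A (carrier G - Y)"
proof -
  have "a \<otimes> y \<notin> Y" if "a \<in> A" "y \<in> carrier G - Y" for a y
  proof
    assume "a \<otimes> y \<in> Y"
    then have "inv a \<otimes> (a \<otimes> y) \<in> Y"
      using assms that by (simp add: invariant_cut_def subgroup.m_inv_closed)
    then show False
      using that subgroup.mem_carrier[OF assms(1) that(1)] by (simp add: inv_solve_left m_assoc[symmetric])
  qed
  then show ?thesis
    using assms subgroup.mem_carrier[OF assms(1)] unfolding invariant_cut_def by auto
qed

lemma invariant_cut_translate:
  assumes A: "subgroup A G" and Y: "invariant_cut G A Y" and g: "g \<in> carrier G"
  shows "invariant_cut G A (Y #> g)"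
proof -
  have Ysub: "Y \<subseteq> carrier G" using Y by (simp add: invariant_cut_def)
  have "Y #> g \<noteq> carrier G"
  proof
    assume eq: "Y #> g = carrier G"
    have "z \<in> Y" if "z \<in> carrier G" for z
    proof -
      have "z \<otimes> g \<in> Y #> g" using eq g that by simp
      then show ?thesis
        using mem_r_coset_iff[OF Ysub g, of "z \<otimes> g"] g that by (simp add: m_assoc)
    qed
    then show False using Y unfolding invariant_cut_def by blast
  qed
  moreover have "a \<otimes> z \<in> Y #> g" if a: "a \<in> A" and z: "z \<in> Y #> g" for a z
  proof -
    obtain y where y: "y \<in> Y" "z = y \<otimes> g" using z by (auto simp: r_coset_def)
    have "a \<otimes> z = (a \<otimes> y) \<otimes> g"
      using y g a Ysub subgroup.mem_carrier[OF A] by (auto simp: m_assoc)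
    moreover have "a \<otimes> y \<in> Y" using Y a y by (simp add: invariant_cut_def)
    ultimately show ?thesis by (auto simp: r_coset_def)
  qed
  ultimately show ?thesis
    using Y g Ysub unfolding invariant_cut_def by (auto simp: r_coset_def)
qed

lemma card_cosets_strict_mono:
  assumes A: "subgroup A G" and fin: "finite (rcosets A)" and Z: "Z \<subseteq> carrier G"
    and Y: "\<And>a y. a \<in> A \<Longrightarrow> y \<in> Y \<Longrightarrow> a \<otimes> y \<in> Y" and YZ: "Y \<subset> Z"
  shows "card ((#>) A ` Y) < card ((#>) A ` Z)"
proof (rule psubset_card_mono)
  have "(#>) A ` Z \<subseteq> rcosets A" using Z by (auto simp: RCOSETS_def)
  then show "finite ((#>) A ` Z)" using fin finite_subset by blast
  obtain z where z: "z \<in> Z" "z \<notin> Y" using YZ by blast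
  have "A #> z \<notin> (#>) A ` Y"
  proof
    assume "A #> z \<in> (#>) A ` Y"
    then obtain y where y: "y \<in> Y" "A #> z = A #> y" by blast
    have "z \<in> A #> z" using A z Z rcos_self by blast
    then show False using y z Y unfolding r_coset_def by auto
  qed
  then show "(#>) A ` Y \<subset> (#>) A ` Z" using YZ z by blast
qed

lemma card_cosets_translate_le:
  assumes "A \<subseteq> carrier G" "finite (rcosets A)" "Y \<subseteq> carrier G" "g \<in> carrier G"
  shows "card ((#>) A ` (Y #> g)) \<le> card ((#>) A ` Y)"
proof -
  have "(#>) A ` (Y #> g) \<subseteq> (\<lambda>C. C #> g) ` ((#>) A ` Y)"
  proof
    fix C assume "C \<in> (#>) A ` (Y #> g)"
    then obtain y where y: "y \<in> Y" "C = A #> (y \<otimes> g)" by (auto simp: r_coset_def)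
    then have "C = (A #> y) #> g" using assms by (auto simp: coset_mult_assoc)
    with y show "C \<in> (\<lambda>C. C #> g) ` ((#>) A ` Y)" by blast
  qed
  moreover have "(#>) A ` Y \<subseteq> rcosets A" using assms by (auto simp: RCOSETS_def)
  then have "finite ((#>) A ` Y)" using assms(2) finite_subset by blast
  ultimately show ?thesis by (meson card_image_le card_mono finite_imageI le_trans)
qed

text \<open>
  Among the cuts crossed by the fewest hyperedges, choose one, \<open>P\<close>, with the fewest vertices, and
  translate it so that it contains \<open>\<one>\<close>. By submodularity, \<open>P\<close> and any of its translates are equal
  or disjoint. Hence \<open>P\<close> is a subgroup, and it contains \<open>A\<close>. It cannot contain \<open>B\<close>, so it contains
  no coset of \<open>B\<close> at all: every hyperedge that meets \<open>P\<close> crosses it, in particular every hyperedge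
  through the vertex \<open>A\<close>.
\<close>
lemma card_split_cosets_ge:
  assumes A: "subgroup A G" and B: "subgroup B G"
    and finA: "finite (rcosets A)" and finB: "finite (rcosets B)"
    and gen: "\<And>L. subgroup L G \<Longrightarrow> A \<subseteq> L \<Longrightarrow> B \<subseteq> L \<Longrightarrow> L = carrier G"
    and Y: "invariant_cut G A Y"
  shows "card ((#>) B ` A) \<le> card (split_cosets G B Y)"
proof -
  let ?c = "\<lambda>Y. card (split_cosets G B Y)" and ?n = "\<lambda>Y. card ((#>) A ` Y)"
  note Asub = subgroup.subset[OF A] and Bsub = subgroup.subset[OF B]
  obtain P0 where P0: "invariant_cut G A P0" "\<And>Z. invariant_cut G A Z \<Longrightarrow> ?c P0 \<le> ?c Z"
    using exists_least_iff[of "\<lambda>n. \<exists>Z. invariant_cut G A Z \<and> ?c Z = n"] Y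
    by (metis (no_types, lifting) not_le)
  obtain P1 where P1: "invariant_cut G A P1" "?c P1 = ?c P0"
      "\<And>Z. invariant_cut G A Z \<Longrightarrow> ?c Z = ?c P0 \<Longrightarrow> ?n P1 \<le> ?n Z"
    using exists_least_iff[of "\<lambda>n. \<exists>Z. invariant_cut G A Z \<and> ?c Z = ?c P0 \<and> ?n Z = n"] P0(1)
    by (metis (no_types, lifting) not_le)
  obtain p where p: "p \<in> P1" "p \<in> carrier G" using P1(1) unfolding invariant_cut_def by blast
  define P where "P = P1 #> inv p"
  have P1sub: "P1 \<subseteq> carrier G" using P1(1) by (simp add: invariant_cut_def)
  have cutP: "invariant_cut G A P" unfolding P_def using invariant_cut_translate[OF A P1(1)] p by simp
  have oneP: "\<one> \<in> P" unfolding P_def using p by (force simp: r_coset_def)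
  have cP: "?c P \<le> ?c Z" if "invariant_cut G A Z" for Z
    using card_split_cosets_translate_le[OF finB Bsub P1sub, of "inv p"] P0(2)[OF that] P1(2) p
    unfolding P_def by simp
  have nP: "?n P \<le> ?n Z" if "invariant_cut G A Z" "?c Z \<le> ?c P" for Z
  proof -
    have "?c Z = ?c P0" using P0(2)[OF that(1)] cP[OF P0(1)] that(2) by simp
    then have "?n P1 \<le> ?n Z" using P1(3) that by blast
    then show ?thesis
      using card_cosets_translate_le[OF Asub finA P1sub, of "inv p"] p unfolding P_def by simp
  qed
  have Psub: "P \<subseteq> carrier G" and Pinv: "\<And>a y. a \<in> A \<Longrightarrow> y \<in> P \<Longrightarrow> a \<otimes> y \<in> P"
    using cutP by (auto simp: invariant_cut_def)
  have translate: "P #> g = P" if g: "g \<in> P" for g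
  proof (rule ccontr)
    assume neq: "P #> g \<noteq> P"
    have gG: "g \<in> carrier G" using g Psub by blast
    let ?Q = "P #> g"
    have cutQ: "invariant_cut G A ?Q" by (rule invariant_cut_translate[OF A cutP gG])
    have Qsub: "?Q \<subseteq> carrier G" and Qinv: "\<And>a y. a \<in> A \<Longrightarrow> y \<in> ?Q \<Longrightarrow> a \<otimes> y \<in> ?Q"
      using cutQ by (auto simp: invariant_cut_def)
    have cQ: "?c ?Q \<le> ?c P" by (rule card_split_cosets_translate_le[OF finB Bsub Psub gG])
    have nQ: "?n ?Q \<le> ?n P" by (rule card_cosets_translate_le[OF Asub finA Psub gG])
    have gQ: "g \<in> ?Q" using oneP gG by (force simp: r_coset_def)
    \<comment> \<open>A smaller intersection would be crossed more often than \<open>P\<close>, hence the union less often, so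
      the union can only be the whole group. Then the complement of \<open>P\<close>, which is crossed by the same
      hyperedges as \<open>P\<close>, fits properly into a translate of \<open>P\<close> and is too small.\<close>
    have inter: "invariant_cut G A (P \<inter> ?Q)"
      using cutP cutQ g gQ unfolding invariant_cut_def by blast
    have "P \<inter> ?Q \<subset> P"
    proof (rule ccontr)
      assume "\<not> P \<inter> ?Q \<subset> P"
      then have "P \<subset> ?Q" using neq by blast
      then have "?n P < ?n ?Q" by (intro card_cosets_strict_mono[OF A finA Qsub Pinv])
      then show False using nQ by simp
    qed
    then have "?n (P \<inter> ?Q) < ?n P"
      using Pinv Qinv by (intro card_cosets_strict_mono[OF A finA Psub]) auto
    then have "?c P < ?c (P \<inter> ?Q)"
      using nP[OF inter] by linarith
    then have "?c (P \<union> ?Q) < ?c P"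
      using card_split_cosets_submodular[OF finB, of P ?Q] cQ by linarith
    then have "\<not> invariant_cut G A (P \<union> ?Q)" using cP by (meson not_le)
    then have un: "P \<union> ?Q = carrier G"
      using cutP cutQ unfolding invariant_cut_def by blast
    have compl: "invariant_cut G A (carrier G - P)" by (rule invariant_cut_complement[OF A cutP])
    then have "?n P \<le> ?n (carrier G - P)"
      by (rule nP) (simp add: split_cosets_complement[OF Bsub])
    also have "\<dots> < ?n ?Q"
      using un g gQ compl unfolding invariant_cut_def
      by (intro card_cosets_strict_mono[OF A finA Qsub]) auto
    finally show False using nQ by simp
  qed
  have subP: "subgroup P G"
  proof (rule subgroupI)
    show "P \<subseteq> carrier G" "P \<noteq> {}" using cutP by (auto simp: invariant_cut_def)
    fix g assume g: "g \<in> P"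
    have gG: "g \<in> carrier G" using g Psub by blast
    have "\<one> \<in> P #> g" using translate[OF g] oneP by simp
    then show "inv g \<in> P"
      using mem_r_coset_iff[OF Psub gG, of \<one>] gG by simp
    show "h \<otimes> g \<in> P" if "h \<in> P" for h
      using translate[OF g] that unfolding r_coset_def by blast
  qed
  have AP: "A \<subseteq> P"
  proof
    fix a assume a: "a \<in> A"
    then have "a \<otimes> \<one> \<in> P" by (rule Pinv[OF _ oneP])
    then show "a \<in> P" using a Asub by auto
  qed
  have BP: "\<not> B \<subseteq> P"
    using gen[OF subP AP] cutP unfolding invariant_cut_def by blast
  have "(#>) B ` A \<subseteq> split_cosets G B P"
  proof
    fix C assume "C \<in> (#>) B ` A"
    then obtain a where a: "a \<in> A" "C = B #> a" by blast
    then have aG: "a \<in> carrier G" and aP: "a \<in> P" using Asub AP by auto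
    have "a \<in> C" using a aG B rcos_self by blast
    moreover have "\<not> C \<subseteq> P"
    proof
      assume "C \<subseteq> P"
      have "b \<in> P" if b: "b \<in> B" for b
      proof -
        have "b \<otimes> a \<in> P #> a" using b a(2) \<open>C \<subseteq> P\<close> translate[OF aP] unfolding r_coset_def by blast
        then show ?thesis
          using mem_r_coset_iff[OF Psub aG, of "b \<otimes> a"] b Bsub aG by (auto simp: m_assoc)
      qed
      then show False using BP by blast
    qed
    moreover have "C \<in> rcosets B" using a(2) aG Bsub by (simp add: rcosetsI)
    ultimately show "C \<in> split_cosets G B P" unfolding split_cosets_def using aP by blast
  qed
  moreover have "finite (split_cosets G B P)" using finB by (simp add: split_cosets_def)
  ultimately have "card ((#>) B ` A) \<le> ?c P" by (rule card_mono[rotated])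
  also have "\<dots> \<le> ?c Y" by (rule cP[OF Y])
  finally show ?thesis .
qed

end

section \<open>The algebra of ends\<close>

context locally_compact_group
begin

lemma has_compact_closure_if_subset_compact:
  assumes "compactin T K" "X \<subseteq> K"
  shows "has_compact_closure T X"
proof -
  have "closedin T K" using assms(1) Hausdorff compactin_imp_closedin by blast
  then have "T closure_of X \<subseteq> K" using assms(2) closure_of_minimal by blast
  then show ?thesis
    unfolding has_compact_closure_def using assms(1) closed_compactin closedin_closure_of by blast
qed

lemma subset_closure: "X \<subseteq> carrier G \<Longrightarrow> X \<subseteq> T closure_of X"
  using closure_of_subset topspace_eq_carrier by metis

lemma has_compact_closure_if_subset_Un:
  assumes "has_compact_closure T X" "has_compact_closure T Y" "X \<subseteq> carrier G" "Y \<subseteq> carrier G"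
    "Z \<subseteq> X \<union> Y"
  shows "has_compact_closure T Z"
proof (rule has_compact_closure_if_subset_compact)
  show "compactin T (T closure_of X \<union> T closure_of Y)"
    using assms by (simp add: has_compact_closure_def compactin_Un)
  show "Z \<subseteq> T closure_of X \<union> T closure_of Y" using assms subset_closure by blast
qed

text \<open>
  In the quotient, a commensurated set is identified with \<open>{}\<close> or with the whole group. The two
  classes are the ideal \<open>I\<close> itself and the set \<open>J\<close> of complements of its members, and the sum and
  product tables are those of \<open>\<int>/2\<int>\<close>.
\<close>
lemma one_ended_if_commensurated_trivial:
  assumes noncompact: "\<not> has_compact_closure T (carrier G)"
    and trivial: "\<And>X. left_commensurated G T X \<Longrightarrow>
      has_compact_closure T X \<or> has_compact_closure T (carrier G - X)"
  shows "one_ended G T"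
proof -
  let ?A = "commensurated_algebra G T" and ?E = "ends_algebra G T"
  define I where "I = compact_closure_ideal G T"
  define J where "J = {X. X \<subseteq> carrier G \<and> carrier G - X \<in> I}"
  have I_closed: "Z \<in> I" if "X \<in> I" "Y \<in> I" "Z \<subseteq> X \<union> Y" for X Y Z
    using that has_compact_closure_if_subset_Un[of X Y Z]
    unfolding I_def compact_closure_ideal_def by blast
  have I_sub: "X \<subseteq> carrier G" if "X \<in> I" for X
    using that by (simp add: I_def compact_closure_ideal_def)
  have empty_I: "{} \<in> I" by (simp add: I_def compact_closure_ideal_def has_compact_closure_def)
  have carrier_I: "carrier G \<notin> I" using noncompact by (simp add: I_def compact_closure_ideal_def)
  have carrier_J: "carrier G \<in> J" by (simp add: J_def empty_I)
  have IJ: "X \<notin> J" if "X \<in> I" for X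
    using I_closed[OF that, of "carrier G - X" "carrier G"] carrier_I unfolding J_def by blast
  then have "I \<noteq> J" using empty_I by blast
  have coset: "I +>\<^bsub>?A\<^esub> X = (\<lambda>Y. sym_diff Y X) ` I" for X
    by (auto simp: a_r_coset_def r_coset_def commensurated_algebra_def)
  have image_eq: "(\<lambda>Y. sym_diff Y X) ` U = V"
    if "\<And>Y. Y \<in> U \<Longrightarrow> sym_diff Y X \<in> V" "\<And>Y. Y \<in> V \<Longrightarrow> sym_diff Y X \<in> U" for X and U V :: "'a set set"
  proof
    show "V \<subseteq> (\<lambda>Y. sym_diff Y X) ` U"
    proof
      fix Y assume "Y \<in> V"
      then show "Y \<in> (\<lambda>Y. sym_diff Y X) ` U"
        by (intro image_eqI[where x = "sym_diff Y X"] that(2)) blast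
    qed
  next
    show "(\<lambda>Y. sym_diff Y X) ` U \<subseteq> V" by (rule image_subsetI) (rule that(1))
  qed
  have coset_I: "I +>\<^bsub>?A\<^esub> X = I" if X: "X \<in> I" for X
  proof -
    have "sym_diff Y X \<in> I" if "Y \<in> I" for Y by (rule I_closed[OF that X]) auto
    then show ?thesis unfolding coset by (intro image_eq)
  qed
  have J_diff: "sym_diff X Y \<in> I" if "X \<in> J" "Y \<in> J" for X Y
  proof (rule I_closed)
    show "carrier G - X \<in> I" "carrier G - Y \<in> I" using that by (auto simp: J_def)
    show "sym_diff X Y \<subseteq> (carrier G - X) \<union> (carrier G - Y)" using that by (auto simp: J_def)
  qed
  have coset_J: "I +>\<^bsub>?A\<^esub> X = J" if X: "X \<in> J" for X
  proof -
    have Xs: "X \<subseteq> carrier G" "carrier G - X \<in> I" using X by (auto simp: J_def)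
    have "sym_diff Y X \<in> J" if "Y \<in> I" for Y
    proof -
      have "carrier G - sym_diff Y X \<in> I" by (rule I_closed[OF that Xs(2)]) auto
      moreover have "sym_diff Y X \<subseteq> carrier G" using I_sub[OF that] Xs(1) by auto
      ultimately show ?thesis by (simp add: J_def)
    qed
    moreover have "sym_diff Y X \<in> I" if "Y \<in> J" for Y by (rule J_diff[OF that X])
    ultimately show ?thesis unfolding coset by (intro image_eq)
  qed
  have comm: "left_commensurated G T {}" "left_commensurated G T (carrier G)"
  proof -
    have "(K <#> carrier G) - carrier G = {}" if "compactin T K" for K
      using compactin_subset_topspace[OF that] topspace_eq_carrier by (auto simp: set_mult_def)
    then have "has_compact_closure T ((K <#> carrier G) - carrier G)" if "compactin T K" for K
      using that by (simp only: has_compact_closure_def closure_of_empty compactin_empty)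
    then show "left_commensurated G T (carrier G)" by (simp add: left_commensurated_def)
    show "left_commensurated G T {}"
      by (simp add: left_commensurated_def has_compact_closure_def set_mult_def)
  qed
  have cE: "carrier ?E = {I, J}"
  proof -
    have "carrier ?E = {I +>\<^bsub>?A\<^esub> X |X. left_commensurated G T X}"
      unfolding ends_algebra_def FactRing_def A_RCOSETS_def RCOSETS_def I_def a_r_coset_def
      by (auto simp: commensurated_algebra_def)
    moreover have "I +>\<^bsub>?A\<^esub> X \<in> {I, J}" if "left_commensurated G T X" for X
    proof -
      have "X \<in> I \<or> X \<in> J"
        using trivial[OF that] that
        unfolding J_def I_def compact_closure_ideal_def left_commensurated_def by blast
      then show ?thesis using coset_I coset_J by blast
    qed
    ultimately show ?thesis
      using coset_I[OF empty_I] coset_J[OF carrier_J] comm by auto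
  qed
  have oneE: "\<one>\<^bsub>?E\<^esub> = J"
    using coset_J[OF carrier_J]
    by (simp add: ends_algebra_def FactRing_def I_def commensurated_algebra_def)
  have mult: "U \<otimes>\<^bsub>?E\<^esub> V = (\<Union>X\<in>U. \<Union>Y\<in>V. I +>\<^bsub>?A\<^esub> (X \<inter> Y))" for U V
    by (simp add: ends_algebra_def FactRing_def rcoset_mult_def I_def commensurated_algebra_def)
  have add: "U \<oplus>\<^bsub>?E\<^esub> V = (\<Union>Y\<in>V. (\<lambda>X. sym_diff X Y) ` U)" for U V
    by (auto simp: ends_algebra_def FactRing_def set_add_def set_mult_def commensurated_algebra_def)
  have I_int: "X \<inter> Y \<in> I" "Y \<inter> X \<in> I" if "X \<in> I" for X Y
    by (rule I_closed[OF that that]; auto)+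
  have J_int: "X \<inter> Y \<in> J" if "X \<in> J" "Y \<in> J" for X Y
  proof -
    have "carrier G - X \<in> I" "carrier G - Y \<in> I" "X \<subseteq> carrier G" using that by (auto simp: J_def)
    moreover from this(1,2) have "carrier G - X \<inter> Y \<in> I" by (rule I_closed) auto
    ultimately show ?thesis by (auto simp: J_def)
  qed
  have nonempty: "I \<noteq> {}" "J \<noteq> {}" using empty_I carrier_J by auto
  have E_mult: "I \<otimes>\<^bsub>?E\<^esub> I = I" "I \<otimes>\<^bsub>?E\<^esub> J = I" "J \<otimes>\<^bsub>?E\<^esub> I = I" "J \<otimes>\<^bsub>?E\<^esub> J = J"
    unfolding mult using nonempty by (simp_all add: I_int J_int coset_I coset_J)
  have E_add_I: "U \<oplus>\<^bsub>?E\<^esub> I = U" if "U = I \<or> U = J" for U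
  proof -
    have "U \<oplus>\<^bsub>?E\<^esub> I = (\<Union>Y\<in>I. (\<lambda>X. sym_diff X Y) ` U)" by (rule add)
    also have "\<dots> = (\<Union>X\<in>U. I +>\<^bsub>?A\<^esub> X)"
      unfolding coset image_def by (auto simp: Un_commute)
    also have "\<dots> = U" using that nonempty by (auto simp: coset_I coset_J)
    finally show ?thesis .
  qed
  have E_add_J: "I \<oplus>\<^bsub>?E\<^esub> J = J"
    unfolding add coset[symmetric] using nonempty by (simp add: coset_J)
  have E_add_JJ: "J \<oplus>\<^bsub>?E\<^esub> J = I"
  proof -
    have "(\<lambda>X. sym_diff X Y) ` J = I" if Y: "Y \<in> J" for Y
    proof (rule image_eq)
      show "sym_diff X Y \<in> I" if "X \<in> J" for X
        by (rule J_diff[OF that Y])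
      show "sym_diff X Y \<in> J" if "X \<in> I" for X
        using coset_J[OF Y] imageI[OF that, of "\<lambda>Z. sym_diff Z Y"] by (simp only: coset)
    qed
    then show ?thesis unfolding add using nonempty by simp
  qed
  define \<omega> :: "'a set set \<Rightarrow> int" where "\<omega> = (\<lambda>U\<in>{I, J}. if U = J then 1 else 0)"
  have \<omega>: "\<omega> I = 0" "\<omega> J = 1" using \<open>I \<noteq> J\<close> by (auto simp: \<omega>_def)
  have "topspace (space_of_ends G T)
      = (PiE {I, J} (\<lambda>_. {0..1})) \<inter> ring_hom ?E (residue_ring 2)"
    by (simp add: space_of_ends_def stone_dual_def cE residue_ring_def)
  also have "\<dots> = {\<omega>}"
  proof -
    have "\<omega> \<in> ring_hom ?E (residue_ring 2)"
      unfolding ring_hom_def using \<omega> E_mult E_add_I E_add_J E_add_JJ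
      by (auto simp: cE oneE residue_ring_def)
    moreover have "\<omega> \<in> PiE {I, J} (\<lambda>_. {0..1})" by (auto simp: \<omega>_def)
    moreover have "f = \<omega>" if f: "f \<in> PiE {I, J} (\<lambda>_. {0..1})" "f \<in> ring_hom ?E (residue_ring 2)" for f
    proof -
      have "f J = 1" using f(2) ring_hom_one[OF f(2)] by (simp add: oneE residue_ring_def)
      moreover have "f I = (f I + f I) mod 2"
        using ring_hom_add[OF f(2), of I I] E_add_I[of I] by (simp add: cE residue_ring_def)
      then have "f I = 0" using PiE_mem[OF f(1), of I] by auto
      ultimately show ?thesis
        using f(1) \<omega> by (intro PiE_ext[OF f(1)]) (auto simp: \<omega>_def)
    qed
    ultimately show ?thesis by blast
  qed
  finally show ?thesis unfolding one_ended_def by blast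
qed

end

section \<open>Compact open subgroups\<close>

context locally_compact_group
begin

lemma continuous_map_right_mult:
  assumes "g \<in> carrier G"
  shows "continuous_map T T (\<lambda>z. z \<otimes> g)"
proof -
  have "continuous_map T (prod_topology T T) (\<lambda>z. (z, g))"
    using assms topspace_eq_carrier by (intro continuous_map_pairedI) auto
  from continuous_map_compose[OF this continuous_mult] show ?thesis by (simp add: o_def)
qed

lemma openin_r_coset:
  assumes "openin T U" "g \<in> carrier G"
  shows "openin T (U #> g)"
proof -
  have U: "U \<subseteq> carrier G" using assms(1) openin_subset topspace_eq_carrier by metis
  have "U #> g = {z \<in> topspace T. z \<otimes> inv g \<in> U}"
    using mem_r_coset_iff[OF U assms(2)] r_coset_subset_G[OF U assms(2)] topspace_eq_carrier by blast
  then show ?thesis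
    using openin_continuous_map_preimage[OF continuous_map_right_mult assms(1)] assms(2) by simp
qed

lemma compactin_r_coset:
  assumes "compactin T K" "g \<in> carrier G"
  shows "compactin T (K #> g)"
proof -
  have "K #> g = (\<lambda>z. z \<otimes> g) ` K" by (auto simp: r_coset_def)
  then show ?thesis using image_compactin[OF assms(1) continuous_map_right_mult] assms(2) by simp
qed

lemma closedin_open_subgroup:
  assumes H: "subgroup H G" "openin T H"
  shows "closedin T H"
proof -
  have "carrier G - H = (\<Union>z\<in>carrier G - H. H #> z)"
  proof
    show "carrier G - H \<subseteq> (\<Union>z\<in>carrier G - H. H #> z)" using H rcos_self by blast
    have "h \<otimes> z \<notin> H" if "h \<in> H" "z \<in> carrier G - H" for h z
      using that H(1) by (metis DiffE subgroup.mem_carrier subgroupE(3) subgroupE(4) inv_solve_left' l_one m_assoc subgroup.m_inv_closed inv_closed l_inv)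
    then show "(\<Union>z\<in>carrier G - H. H #> z) \<subseteq> carrier G - H"
      using subgroup.mem_carrier[OF H(1)] by (auto simp: r_coset_def)
  qed
  moreover have "openin T (\<Union>z\<in>carrier G - H. H #> z)"
    using H(2) openin_r_coset by blast
  ultimately show ?thesis
    using subgroup.subset[OF H(1)] topspace_eq_carrier unfolding closedin_def by metis
qed

text \<open>
  The cosets form an open cover by pairwise disjoint sets, which has no proper subcover.
\<close>
lemma finite_cosets_meeting_compact:
  assumes H: "subgroup H G" "openin T H" and K: "compactin T K"
  shows "finite ((#>) H ` K)"
proof -
  have Ksub: "K \<subseteq> carrier G" using K compactin_subset_topspace topspace_eq_carrier by metis
  have "\<forall>U\<in>(#>) H ` K. openin T U" using H(2) Ksub openin_r_coset by blast
  moreover have "K \<subseteq> \<Union>((#>) H ` K)" using Ksub H(1) rcos_self by blast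
  ultimately obtain F where F: "finite F" "F \<subseteq> (#>) H ` K" "K \<subseteq> \<Union>F"
    using compactinD[OF K, of "(#>) H ` K"] by blast
  have "(#>) H ` K \<subseteq> F"
  proof
    fix C assume "C \<in> (#>) H ` K"
    then obtain z where z: "z \<in> K" "C = H #> z" by blast
    then obtain D where D: "D \<in> F" "z \<in> D" using F(3) by blast
    then obtain z' where z': "z' \<in> K" "D = H #> z'" using F(2) by blast
    have "H #> z' = H #> z"
      using repr_independence[OF _ _ H(1), of z z'] D(2) z' Ksub by blast
    then show "C \<in> F" using z(2) z'(2) D(1) by simp
  qed
  then show ?thesis using F(1) finite_subset by blast
qed

lemma subset_compact_if_finite_cosets:
  assumes B: "subgroup B G" "compactin T B" and Z: "Z \<subseteq> carrier G" and fin: "finite ((#>) B ` Z)"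
  obtains K where "compactin T K" "Z \<subseteq> K"
proof
  show "compactin T (\<Union>((#>) B ` Z))"
    using fin compactin_r_coset[OF B(2)] Z by (intro compactin_Union) auto
  show "Z \<subseteq> \<Union>((#>) B ` Z)" using Z B(1) rcos_self by blast
qed

end

section \<open>Commensurated subsets of regionally elliptic groups\<close>

definition compact_open_subgroup :: "('a, 'b) monoid_scheme \<Rightarrow> 'a topology \<Rightarrow> 'a set \<Rightarrow> bool" where
  "compact_open_subgroup G T H \<longleftrightarrow> subgroup H G \<and> openin T H \<and> compactin T H"

context locally_compact_group
begin

lemma compact_open_subgroup_containing:
  assumes "regionally_elliptic G T" "compactin T K"
  obtains H where "compact_open_subgroup G T H" "K \<subseteq> H"
  using assms unfolding regionally_elliptic_def compact_open_subgroup_def by blast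

text \<open>
  The last two properties keep the traces of \<open>X\<close> and of its complement on the union of the chain from
  being contained in one member of the chain, so that they cannot have compact closure.
\<close>
lemma commensurating_chain:
  assumes ell: "regionally_elliptic G T" and X: "left_commensurated G T X"
    and nX: "\<not> has_compact_closure T X" and nX': "\<not> has_compact_closure T (carrier G - X)"
  obtains H :: "nat \<Rightarrow> 'a set" where "\<And>n. compact_open_subgroup G T (H n)"
    "\<And>n. H n \<subseteq> H (Suc n)" "\<And>n. (H n <#> X) - X \<subseteq> H (Suc n)"
    "\<And>n. \<not> X \<inter> H (Suc n) \<subseteq> H n" "\<And>n. \<not> H (Suc n) - X \<subseteq> H n"
proof -
  have Xsub: "X \<subseteq> carrier G" using X by (simp add: left_commensurated_def)
  have base: "\<exists>H. compact_open_subgroup G T H"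
    using compact_open_subgroup_containing[OF ell, of "{}"] by auto
  have step: "\<exists>H'. compact_open_subgroup G T H' \<and>
      (H \<subseteq> H' \<and> (H <#> X) - X \<subseteq> H' \<and> \<not> X \<inter> H' \<subseteq> H \<and> \<not> H' - X \<subseteq> H)"
    if H: "compact_open_subgroup G T H" for H
  proof -
    have Hc: "compactin T H" using H by (simp add: compact_open_subgroup_def)
    have Hsub: "H \<subseteq> carrier G" using H by (simp add: compact_open_subgroup_def subgroup.subset)
    obtain x where x: "x \<in> X" "x \<notin> H"
      using nX has_compact_closure_if_subset_compact[OF Hc] by blast
    obtain y where y: "y \<in> carrier G" "y \<notin> X" "y \<notin> H"
      using nX' has_compact_closure_if_subset_compact[OF Hc] by blast
    have "has_compact_closure T ((H <#> X) - X)"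
      using X Hc by (simp add: left_commensurated_def)
    moreover have "compactin T {x, y}"
      using x y Xsub topspace_eq_carrier by (intro finite_imp_compactin) auto
    ultimately have "compactin T (H \<union> (T closure_of ((H <#> X) - X) \<union> {x, y}))"
      using Hc unfolding has_compact_closure_def by (intro compactin_Un)
    then obtain H' where H': "compact_open_subgroup G T H'"
        "H \<union> (T closure_of ((H <#> X) - X) \<union> {x, y}) \<subseteq> H'"
      using compact_open_subgroup_containing[OF ell] by blast
    have "(H <#> X) - X \<subseteq> T closure_of ((H <#> X) - X)"
      using Hsub Xsub by (intro subset_closure) (auto simp: set_mult_def)
    then show ?thesis using H' x y by blast
  qed
  obtain H where "\<And>n. compact_open_subgroup G T (H n)"
    "\<And>n. H n \<subseteq> H (Suc n) \<and> (H n <#> X) - X \<subseteq> H (Suc n)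
        \<and> \<not> X \<inter> H (Suc n) \<subseteq> H n \<and> \<not> H (Suc n) - X \<subseteq> H n"
    using dependent_nat_choice[of "\<lambda>_. compact_open_subgroup G T"
        "\<lambda>_ H H'. H \<subseteq> H' \<and> (H <#> X) - X \<subseteq> H' \<and> \<not> X \<inter> H' \<subseteq> H \<and> \<not> H' - X \<subseteq> H"]
      base step by metis
  then show thesis using that by blast
qed

lemma compact_subset_of_chain:
  fixes H :: "nat \<Rightarrow> 'a set"
  assumes "compactin T K" "\<And>n. openin T (H n)" "mono H" "K \<subseteq> (\<Union>n. H n)"
  obtains n where "K \<subseteq> H n"
proof -
  obtain F where "finite F" "F \<subseteq> range H" "K \<subseteq> \<Union>F"
    using compactinD[OF assms(1), of "range H"] assms(2,4) by blast
  then obtain N where N: "finite N" "K \<subseteq> \<Union>(H ` N)"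
    by (metis finite_subset_image)
  have "H i \<subseteq> H (Max N)" if "i \<in> N" for i using N(1) that assms(3) by (simp add: monoD)
  then show thesis using that N by blast
qed

lemma subgroup_Union_chain:
  fixes H :: "nat \<Rightarrow> 'a set"
  assumes "\<And>n. subgroup (H n) G" "mono H"
  shows "subgroup (\<Union>n. H n) G"
proof (rule subgroupI)
  show "(\<Union>n. H n) \<subseteq> carrier G" using assms(1) subgroup.subset by blast
  show "(\<Union>n. H n) \<noteq> {}" using assms(1) subgroup.one_closed by blast
  show "inv a \<in> (\<Union>n. H n)" if a: "a \<in> (\<Union>n. H n)" for a
  proof -
    obtain i where "a \<in> H i" using a by blast
    then have "inv a \<in> H i" by (rule subgroup.m_inv_closed[OF assms(1)])
    then show ?thesis by blast
  qed
  show "a \<otimes> b \<in> (\<Union>n. H n)" if ab: "a \<in> (\<Union>n. H n)" "b \<in> (\<Union>n. H n)" for a b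
  proof -
    obtain i j where "a \<in> H i" "b \<in> H j" using ab by blast
    then have "a \<in> H (max i j)" "b \<in> H (max i j)"
      using monoD[OF assms(2)] by (meson max.cobounded1 max.cobounded2 subsetD)+
    then have "a \<otimes> b \<in> H (max i j)" by (rule subgroup.m_closed[OF assms(1)])
    then show ?thesis by blast
  qed
qed

text \<open>
  Let the subgroup \<open>M\<close> contain \<open>B\<close> and every point outside of \<open>X\<close> that \<open>B\<close> reaches from \<open>X\<close>.
  Then no point outside of \<open>M\<close> leaves \<open>X\<close> under \<open>B\<close>. None enters \<open>X\<close> either: if \<open>b\<close> moves \<open>z\<close> into
  \<open>X\<close>, then \<open>z\<close> is reached from \<open>X\<close> by \<open>inv b\<close>.
\<close>
lemma commensurated_off_subgroup:
  assumes M: "subgroup M G" and B: "subgroup B G" "B \<subseteq> M"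
    and X: "X \<subseteq> carrier G" and BX: "(B <#> X) - X \<subseteq> M"
    and b: "b \<in> B" and z: "z \<in> carrier G" "z \<notin> M"
  shows "b \<otimes> z \<notin> M" "b \<otimes> z \<in> X \<longleftrightarrow> z \<in> X"
proof -
  have bG: "b \<in> carrier G" by (rule subgroup.mem_carrier[OF B(1) b])
  have zb: "inv b \<otimes> (b \<otimes> z) = z" using bG z by (simp add: m_assoc[symmetric])
  have bM: "b \<in> M" "inv b \<in> B" using b B(2) subgroup.m_inv_closed[OF B(1)] by auto
  show n: "b \<otimes> z \<notin> M"
    using zb z(2) bM B(2) subgroup.m_closed[OF M, of "inv b" "b \<otimes> z"] by auto
  have "b \<otimes> z \<in> X" if "z \<in> X"
  proof -
    have "b \<otimes> z \<in> B <#> X" using b that by (auto simp: set_mult_def)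
    then show ?thesis using n BX by blast
  qed
  moreover have "z \<in> X" if "b \<otimes> z \<in> X"
  proof -
    have "inv b \<otimes> (b \<otimes> z) \<in> B <#> X" using bM(2) that by (auto simp only: set_mult_def)
    then show ?thesis using z(2) BX unfolding zb by blast
  qed
  ultimately show "b \<otimes> z \<in> X \<longleftrightarrow> z \<in> X" by blast
qed

text \<open>
  With \<open>L\<close>, \<open>A\<close> and \<open>B\<close> as in the introduction, let \<open>d\<close> be the number of cosets of \<open>B\<close> that meet
  \<open>A\<close>, let \<open>s\<close> and \<open>r\<close> count those among them that lie in \<open>X\<close> and that avoid \<open>X\<close>, and let \<open>k\<close> be
  the number of cosets of \<open>B\<close> in \<open>B'\<close>. The lower bound on cuts gives \<open>d \<le> k + s\<close>, while
  \<open>s + r \<le> d\<close>, so that \<open>r \<le> k\<close>. Here \<open>k\<close> is fixed before \<open>n\<close>, and \<open>r\<close> is unbounded in \<open>n\<close>.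
\<close>
lemma commensurated_has_compact_closure_or_complement:
  assumes ell: "regionally_elliptic G T" and nsc: "\<not> sigma_compact_space T"
    and X: "left_commensurated G T X"
  shows "has_compact_closure T X \<or> has_compact_closure T (carrier G - X)"
proof (rule ccontr)
  assume "\<not> ?thesis"
  then obtain H :: "nat \<Rightarrow> 'a set" where cos: "\<And>n. compact_open_subgroup G T (H n)"
    and inc: "\<And>n. H n \<subseteq> H (Suc n)" and HX: "\<And>n. (H n <#> X) - X \<subseteq> H (Suc n)"
    and large: "\<And>n. \<not> X \<inter> H (Suc n) \<subseteq> H n" and large': "\<And>n. \<not> H (Suc n) - X \<subseteq> H n"
    using commensurating_chain[OF ell X] by blast
  have Xsub: "X \<subseteq> carrier G" using X by (simp add: left_commensurated_def)
  have subH: "\<And>n. subgroup (H n) G" and openH: "\<And>n. openin T (H n)"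
    and compH: "\<And>n. compactin T (H n)" using cos by (auto simp: compact_open_subgroup_def)
  have monoH: "mono H" using inc by (simp add: mono_iff_le_Suc)
  define M where "M = (\<Union>n. H n)"
  have subM: "subgroup M G" unfolding M_def by (rule subgroup_Union_chain[OF subH monoH])
  have Msub: "M \<subseteq> carrier G" using subM by (rule subgroup.subset)
  have HM: "H n \<subseteq> M" for n unfolding M_def by blast
  have "closedin T M"
    using closedin_open_subgroup[OF subM] openH unfolding M_def by blast
  have MX: "(M <#> X) - X \<subseteq> M"
  proof
    fix z assume z: "z \<in> (M <#> X) - X"
    then obtain n where "z \<in> (H n <#> X) - X" unfolding M_def set_mult_def by blast
    then show "z \<in> M" using HX HM by blast
  qed
  have "M \<noteq> carrier G"
  proof
    assume "M = carrier G"
    then have "sigma_compact_space T"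
      unfolding sigma_compact_space_def
      by (intro exI[of _ "range H"]) (auto simp: topspace_eq_carrier M_def compH)
    then show False using nsc by blast
  qed
  then obtain x where x: "x \<in> carrier G" "x \<notin> M" using Msub by blast
  then obtain B where B: "compact_open_subgroup G T B" "x \<in> B"
    using compact_open_subgroup_containing[OF ell, of "{x}"] topspace_eq_carrier by auto
  have subB: "subgroup B G" and openB: "openin T B" and compB: "compactin T B"
    using B by (auto simp: compact_open_subgroup_def)
  have Bsub: "B \<subseteq> carrier G" by (rule subgroup.subset[OF subB])
  have "compactin T (B \<union> T closure_of ((B <#> X) - X))"
    using X compB by (intro compactin_Un) (auto simp: left_commensurated_def has_compact_closure_def)
  then obtain B' where B': "compact_open_subgroup G T B'" "B \<union> T closure_of ((B <#> X) - X) \<subseteq> B'"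
    using compact_open_subgroup_containing[OF ell] by blast
  have "(B <#> X) - X \<subseteq> T closure_of ((B <#> X) - X)"
    using Bsub Xsub by (intro subset_closure) (auto simp: set_mult_def)
  then have BX: "(B <#> X) - X \<subseteq> B'" and BB': "B \<subseteq> B'" using B'(2) by auto
  have subB': "subgroup B' G" and compB': "compactin T B'"
    using B'(1) by (auto simp: compact_open_subgroup_def)
  have offB': "b \<otimes> z \<in> X \<longleftrightarrow> z \<in> X" if "b \<in> B" "z \<in> carrier G" "z \<notin> B'" for b z
    using commensurated_off_subgroup[OF subB' subB BB' Xsub BX] that by blast
  let ?W = "(#>) B ` B'"
  have finW: "finite ?W" by (rule finite_cosets_meeting_compact[OF subB openB compB'])
  \<comment> \<open>Finitely many cosets of \<open>B\<close> would enclose \<open>Z\<close> in a compact subset of the closed subgroup \<open>M\<close>.\<close>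
  have inf: "infinite ((#>) B ` Z)" if Z: "Z \<subseteq> M" "\<And>n. \<not> Z \<subseteq> H n" for Z
  proof
    assume "finite ((#>) B ` Z)"
    then obtain K where K: "compactin T K" "Z \<subseteq> K"
      using subset_compact_if_finite_cosets[OF subB compB] Z(1) Msub by blast
    have "compactin T (K \<inter> M)" using K(1) \<open>closedin T M\<close> compact_Int_closedin by blast
    then obtain n where "K \<inter> M \<subseteq> H n"
      using compact_subset_of_chain[OF _ openH monoH, of "K \<inter> M"] unfolding M_def by blast
    then show False using Z K(2) by blast
  qed
  have "\<not> M \<inter> X \<subseteq> H n" "\<not> M - X \<subseteq> H n" for n
    using large[of n] large'[of n] HM[of "Suc n"] by blast+
  then have infX: "infinite ((#>) B ` (M \<inter> X))" and infX': "infinite ((#>) B ` (M - X))"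
    by (intro inf; blast)+
  \<comment> \<open>The point \<open>z0\<close> serves to make the cut nonempty.\<close>
  obtain z0 where z0: "z0 \<in> M" "z0 \<in> X" "z0 \<notin> B'"
  proof -
    have "\<not> (#>) B ` (M \<inter> X) \<subseteq> ?W" using infX finW finite_subset by blast
    then show thesis using that by blast
  qed
  \<comment> \<open>\<open>F\<close> provides one more hyperedge avoiding \<open>X\<close> than there are exceptional ones.\<close>
  obtain F where F: "finite F" "F \<subseteq> (#>) B ` (M - X) - ?W" "card F = Suc (card ?W)"
    using infX' finW infinite_arbitrarily_large[of "(#>) B ` (M - X) - ?W" "Suc (card ?W)"] by auto
  obtain n0 where n0: "z0 \<in> H n0" using z0 unfolding M_def by blast
  have "\<forall>C\<in>F. \<exists>n. C \<in> (#>) B ` (H n - X)" using F(2) unfolding M_def by blast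
  then obtain \<nu> where \<nu>: "\<And>C. C \<in> F \<Longrightarrow> C \<in> (#>) B ` (H (\<nu> C) - X)" by metis
  define n where "n = Max (insert n0 (\<nu> ` F))"
  have nn: "z0 \<in> H n" "\<And>C. C \<in> F \<Longrightarrow> C \<in> (#>) B ` (H n - X)"
  proof -
    have "H n0 \<subseteq> H n" using F(1) by (intro monoD[OF monoH]) (simp add: n_def)
    then show "z0 \<in> H n" using n0 by blast
    fix C assume C: "C \<in> F"
    have "H (\<nu> C) \<subseteq> H n" using F(1) C by (intro monoD[OF monoH]) (simp add: n_def)
    then show "C \<in> (#>) B ` (H n - X)" using \<nu>[OF C] by blast
  qed
  define L where "L = generate G (H n \<union> B)"
  \<comment> \<open>\<open>L \<inter> M\<close> and not \<open>H n\<close>: \<open>X\<close> is known to be invariant under \<open>H n\<close> only off a larger set.\<close>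
  define A where "A = L \<inter> M"
  have gens: "H n \<union> B \<subseteq> carrier G" using Bsub subgroup.subset[OF subH] by blast
  have subL: "subgroup L G" unfolding L_def by (rule generate_is_subgroup[OF gens])
  have genL: "H n \<union> B \<subseteq> L" unfolding L_def by (auto intro: generate.incl)
  have Lsub: "L \<subseteq> carrier G" by (rule subgroup.subset[OF subL])
  have subA: "subgroup A G" unfolding A_def by (rule subgroups_Inter_pair[OF subL subM])
  have HA: "H n \<subseteq> A" using genL HM unfolding A_def by blast
  obtain Q where Q: "compact_open_subgroup G T Q" "H n \<union> B \<subseteq> Q"
    using compact_open_subgroup_containing[OF ell, of "H n \<union> B"] compB compH compactin_Un by blast
  have LQ: "L \<subseteq> Q"
    unfolding L_def using Q by (intro generate_subgroup_incl) (auto simp: compact_open_subgroup_def)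
  have compQ: "compactin T Q" using Q(1) by (simp add: compact_open_subgroup_def)
  let ?S = "G\<lparr>carrier := L\<rparr>"
  interpret S: group ?S using subL by (rule subgroup_imp_group)
  have r_coset_S: "U #>\<^bsub>?S\<^esub> z = U #> z" for U z by (simp add: r_coset_def)
  have rcosets_S: "rcosets\<^bsub>?S\<^esub> U = (#>) U ` L" for U
    by (auto simp: RCOSETS_def r_coset_S)
  have finB: "finite ((#>) B ` L)"
    using finite_cosets_meeting_compact[OF subB openB compQ] LQ by (meson finite_subset image_mono)
  have finA: "finite ((#>) A ` L)"
  proof -
    have "A <#> (H n #> z) = A #> z" if "z \<in> carrier G" for z
    proof -
      have "A <#> H n = A"
      proof
        show "A <#> H n \<subseteq> A" using HA subgroup.m_closed[OF subA] by (auto simp: set_mult_def)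
        show "A \<subseteq> A <#> H n"
          using subgroup.one_closed[OF subH] subgroup.mem_carrier[OF subA] unfolding set_mult_def
          by (force intro: r_one[symmetric])
      qed
      then show ?thesis
        using setmult_rcos_assoc[of A "H n" z] that subgroup.subset[OF subA] subgroup.subset[OF subH]
        by simp
    qed
    then have "(#>) A ` L = (\<lambda>C. A <#> C) ` ((#>) (H n) ` L)"
      unfolding image_image using Lsub by (intro image_cong) auto
    moreover have "finite ((#>) (H n) ` L)"
      using finite_cosets_meeting_compact[OF subH openH compQ] LQ by (meson finite_subset image_mono)
    ultimately show ?thesis by simp
  qed
  \<comment> \<open>Taking out all of \<open>A\<close> makes \<open>Y\<close> invariant under \<open>A\<close>: inside \<open>L\<close>, the set \<open>A\<close> is all of \<open>M\<close>.\<close>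
  define Y where "Y = X \<inter> L - A"
  have xz0: "x \<otimes> z0 \<in> Y"
  proof -
    have z0G: "z0 \<in> carrier G" using z0 Xsub by blast
    have "x \<otimes> z0 \<in> X" using offB'[OF B(2) z0G z0(3)] z0(2) by simp
    moreover have "x \<otimes> z0 \<in> L"
      using genL nn(1) B(2) by (intro subgroup.m_closed[OF subL]) auto
    moreover have "x \<otimes> z0 \<notin> M"
    proof
      assume "x \<otimes> z0 \<in> M"
      then have "x \<otimes> z0 \<otimes> inv z0 \<in> M"
        using z0(1) subM subgroup.m_closed subgroup.m_inv_closed by metis
      then show False using x z0G by (simp add: m_assoc)
    qed
    ultimately show ?thesis by (simp add: Y_def A_def)
  qed
  have cutY: "invariant_cut ?S A Y"
  proof -
    have "a \<otimes> y \<in> Y" if a: "a \<in> A" and y: "y \<in> Y" for a y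
    proof -
      have aM: "a \<in> M" "a \<in> L" using a by (auto simp: A_def)
      have yM: "y \<in> carrier G" "y \<notin> M" "y \<in> X" "y \<in> L"
        using y Xsub by (auto simp: Y_def A_def)
      show ?thesis
        using commensurated_off_subgroup[OF subM subM order_refl Xsub MX aM(1) yM(1,2)]
          yM(3) subgroup.m_closed[OF subL aM(2) yM(4)]
        by (simp add: Y_def A_def)
    qed
    moreover have "\<one> \<in> L - Y"
      using subgroup.one_closed[OF subL] subgroup.one_closed[OF subA] by (simp add: Y_def)
    ultimately show ?thesis using xz0 unfolding invariant_cut_def Y_def by auto
  qed
  let ?SS = "{C \<in> (#>) B ` A. C \<subseteq> X}" and ?RR = "{C \<in> (#>) B ` A. C \<inter> X = {}}"
  have finBA: "finite ((#>) B ` A)"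
    using finB by (rule finite_subset[rotated]) (auto simp: A_def)
  have "card ((#>) B ` A) \<le> card (split_cosets ?S B Y)"
  proof -
    have "card ((#>\<^bsub>?S\<^esub>) B ` A) \<le> card (split_cosets ?S B Y)"
    proof (rule S.card_split_cosets_ge)
      show "subgroup A ?S" using subA subL by (intro subgroup_incl) (auto simp: A_def)
      show "subgroup B ?S" using subB subL genL by (intro subgroup_incl) auto
      show "finite (rcosets\<^bsub>?S\<^esub> A)" "finite (rcosets\<^bsub>?S\<^esub> B)"
        using finA finB by (simp_all add: rcosets_S)
      show "K = carrier ?S" if K: "subgroup K ?S" "A \<subseteq> K" "B \<subseteq> K" for K
      proof -
        have "subgroup K G" using incl_subgroup[OF subL K(1)] .
        then have "L \<subseteq> K"
          unfolding L_def using K HA by (intro generate_subgroup_incl) auto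
        then show ?thesis using subgroup.subset[OF K(1)] by auto
      qed
    qed (rule cutY)
    then show ?thesis by (simp add: r_coset_S[abs_def])
  qed
  also have "\<dots> \<le> card (?W \<union> ?SS)"
  proof (rule card_mono)
    show "finite (?W \<union> ?SS)" using finW finBA by simp
    show "split_cosets ?S B Y \<subseteq> ?W \<union> ?SS"
    proof
      fix C assume "C \<in> split_cosets ?S B Y"
      then obtain h where h: "h \<in> L" "C = B #> h" and CY: "C \<inter> Y \<noteq> {}" "\<not> C \<subseteq> Y"
        unfolding split_cosets_def rcosets_S by blast
      show "C \<in> ?W \<union> ?SS"
      proof (cases "h \<in> B'")
        case True
        then show ?thesis using h by blast
      next
        case False
        have hG: "h \<in> carrier G" using h Lsub by blast
        have "h \<in> X"
          using CY(1) offB'[OF _ hG False] unfolding h Y_def by (auto simp: r_coset_def)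
        then have CX: "C \<subseteq> X" using offB'[OF _ hG False] unfolding h by (auto simp: r_coset_def)
        have CL: "C \<subseteq> L"
          using h genL subgroup.m_closed[OF subL] by (auto simp: r_coset_def)
        obtain c where c: "c \<in> C" "c \<in> A" using CY(2) CX CL unfolding Y_def by blast
        have "C = B #> c" using repr_independence[OF _ hG subB] c h by blast
        then show ?thesis using c CX by blast
      qed
    qed
  qed
  also have "\<dots> \<le> card ?W + card ?SS" by (rule card_Un_le)
  finally have upper: "card ((#>) B ` A) \<le> card ?W + card ?SS" .
  have "F \<subseteq> ?RR"
  proof
    fix C assume C: "C \<in> F"
    then obtain z where z: "z \<in> H n" "z \<notin> X" "C = B #> z" using nn(2) by blast
    have "z \<notin> B'" using F(2) C z by blast
    moreover have zG: "z \<in> carrier G" using z(1) HM Msub by blast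
    ultimately have "C \<inter> X = {}" using offB'[of _ z] z by (auto simp: r_coset_def)
    then show "C \<in> ?RR" using z HA by blast
  qed
  then have "Suc (card ?W) \<le> card ?RR" using F(3) finBA card_mono[of ?RR F] by simp
  moreover have "card ?SS + card ?RR \<le> card ((#>) B ` A)"
  proof -
    have ne: "C \<noteq> {}" if "C \<in> (#>) B ` A" for C
      using that rcos_self[OF _ subB] subgroup.mem_carrier[OF subA] by blast
    have "?SS \<inter> ?RR = {}"
    proof (rule equals0I)
      fix C assume C: "C \<in> ?SS \<inter> ?RR"
      then have "C = {}" by blast
      moreover have "C \<in> (#>) B ` A" using C by simp
      ultimately show False using ne by blast
    qed
    then have "card ?SS + card ?RR = card (?SS \<union> ?RR)"
      using finBA by (intro card_Un_disjoint[symmetric]) auto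
    also have "\<dots> \<le> card ((#>) B ` A)" using finBA by (intro card_mono) auto
    finally show ?thesis .
  qed
  ultimately show False using upper by linarith
qed

end

theorem theorem1p26:
  fixes G :: "('a, 'b) monoid_scheme" and T :: "'a topology"
  assumes "locally_compact_group G T"
    and "regionally_elliptic G T"
    and "\<not> sigma_compact_space T"
  shows "one_ended G T"
proof -
  interpret locally_compact_group G T by (rule assms(1))
  have "\<not> has_compact_closure T (carrier G)"
  proof
    assume "has_compact_closure T (carrier G)"
    then have "compactin T (topspace T)"
      by (simp add: has_compact_closure_def flip: topspace_eq_carrier)
    then have "sigma_compact_space T"
      unfolding sigma_compact_space_def by (intro exI[of _ "{topspace T}"]) simp
    then show False using assms(3) by blast
  qed
  then show ?thesis
    using one_ended_if_commensurated_trivial commensurated_has_compact_closure_or_complement[OF assms(2,3)] by blast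
qed

end
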